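(* Let $P=\{p_k;k\ge 1\}$ be a probability distribution on a countable alphabet, let $K=\sum_{k\ge 1}1[p_k>0]$ be its effective cardinality, and let $t_n=\sum_{k\ge 1}np_k(1-p_k)^n$ for $n\ge 1$. Then $K<\infty$ if and only if there is a constant $q_0\in(0,1)$ such that $t_n\le\mathcal{O}(nq_0^n)$ as $n\to\infty$.
   Context: A probability distribution on the countable alphabet $\mathscr{X}=\{\ell_k;k\ge 1\}$ is a sequence $P=\{p_k;k\ge 1\}$ with $p_k\ge 0$ and $\sum_{k\ge1}p_k=1$. The quantity $t_n$ is called the tail index of $P$. The notation $t_n\le\mathcal{O}(nq_0^n)$ means that there is a constant $C>0$ with $t_n\le C\,nq_0^n$ for all sufficiently large $n$. *)

theory Defs
  imports "HOL-Analysis.Analysis"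
begin

text \<open>
  A distribution on a countable alphabet is a sequence of weights indexed by \<open>k \<ge> 1\<close>.
  All notions range over the index set \<open>{1..}\<close>; the value \<open>p 0\<close> plays no role.
\<close>

definition prob_distribution :: "(nat \<Rightarrow> real) \<Rightarrow> bool" where
  "prob_distribution p \<longleftrightarrow> (\<forall>k\<ge>1. p k \<ge> 0) \<and> (p has_sum 1) {1..}"

text \<open>
  Valued in \<^typ>\<open>enat\<close>, where every such sum converges: \<open>\<infinity>\<close> if infinitely many weights
  are positive.
\<close>

definition effective_cardinality :: "(nat \<Rightarrow> real) \<Rightarrow> enat" where
  "effective_cardinality p = (\<Sum>\<^sub>\<infinity>k\<in>{1..}. of_bool (p k > 0))"

text \<open>
  For a distribution, the summands lie between \<open>0\<close> and \<open>n * p k\<close>, so the sum below is a genuine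
  one and not the default value \<open>0\<close> of \<open>infsum\<close>.
\<close>

definition tail_index :: "(nat \<Rightarrow> real) \<Rightarrow> nat \<Rightarrow> real" where
  "tail_index p n = (\<Sum>\<^sub>\<infinity>k\<in>{1..}. real n * p k * (1 - p k) ^ n)"

text \<open>One-sided, without absolute values (unlike the library's \<open>bigo\<close>).\<close>

definition le_bigo :: "(nat \<Rightarrow> real) \<Rightarrow> (nat \<Rightarrow> real) \<Rightarrow> bool" where
  "le_bigo f g \<longleftrightarrow> (\<exists>C>0. \<forall>\<^sub>F n in sequentially. f n \<le> C * g n)"

end

theory Submission
  imports Defs
begin

text \<open>
  If finitely many weights are positive, then \<open>q\<^sub>0 = max (1/2) (1 - p\<^sub>m\<^sub>i\<^sub>n)\<close> works, where
  \<open>p\<^sub>m\<^sub>i\<^sub>n\<close> is the least positive weight; the maximum only ensures \<open>q\<^sub>0 > 0\<close>. If infinitely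
  many are positive, then for every \<open>q\<^sub>0 < 1\<close> some weight satisfies \<open>0 < p k < 1 - q\<^sub>0\<close>, and its
  single term \<open>n p k (1 - p k)\<^sup>n\<close> already outgrows every multiple of \<open>n q\<^sub>0\<^sup>n\<close>.
\<close>

text \<open>Discarding the zero summands leaves a sum of ones over the support. In
  \<open>enat\<close> this is the cardinality if the support is finite, and
  \<open>\<infinity>\<close> otherwise, since infinitely many terms are bounded below by 1.\<close>

lemma effective_cardinality_finite_iff:
  "effective_cardinality p < \<infinity> \<longleftrightarrow> finite {k\<in>{1..}. p k > 0}"
proof -
  let ?S = "{k\<in>{1..}. p k > 0}"
  have "effective_cardinality p = (\<Sum>\<^sub>\<infinity>k\<in>?S. 1)"
    unfolding effective_cardinality_def by (rule infsum_cong_neutral) auto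
  moreover have "(\<Sum>\<^sub>\<infinity>k\<in>?S. 1) = (\<infinity>::enat)" if "infinite ?S"
    by (rule infsum_superconst_infinite_enat[of _ 1]) (use that in auto)
  moreover have "(\<Sum>\<^sub>\<infinity>k\<in>?S. 1) < (\<infinity>::enat)" if "finite ?S"
    using that by (simp flip: of_nat_eq_enat)
  ultimately show ?thesis
    by (cases "finite ?S") simp_all
qed

context
  fixes p :: "nat \<Rightarrow> real"
  assumes p: "prob_distribution p"
begin

lemma prob_distribution_nonneg: "k \<ge> 1 \<Longrightarrow> 0 \<le> p k"
  using p by (simp add: prob_distribution_def)

lemma prob_distribution_has_sum: "(p has_sum 1) {1..}"
  using p by (simp add: prob_distribution_def)

lemma prob_distribution_sum_le_1:
  assumes "finite F" "F \<subseteq> {1..}"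
  shows "sum p F \<le> 1"
  using assms prob_distribution_nonneg
  by (intro finite_sum_le_has_sum[OF prob_distribution_has_sum]) auto

lemma prob_distribution_le_1: "k \<ge> 1 \<Longrightarrow> p k \<le> 1"
  using prob_distribution_sum_le_1[of "{k}"] by simp

lemma tail_term_nonneg: "k \<ge> 1 \<Longrightarrow> 0 \<le> real n * p k * (1 - p k) ^ n"
  using prob_distribution_nonneg prob_distribution_le_1 by simp

text \<open>The factor \<open>(1 - p k) ^ n\<close> is at most 1, so the summable family
  \<open>real n * p k\<close> dominates. Both later bounds on \<open>tail_index\<close> rest on
  this.\<close>

lemma tail_index_summable: "(\<lambda>k. real n * p k * (1 - p k) ^ n) summable_on {1..}"
proof (rule summable_on_comparison_test)
  show "(\<lambda>k. real n * p k) summable_on {1..}"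
    by (intro summable_on_cmult_right has_sum_imp_summable[OF prob_distribution_has_sum])
  fix k :: nat assume k: "k \<in> {1..}"
  then show "real n * p k * (1 - p k) ^ n \<le> real n * p k"
    using prob_distribution_nonneg prob_distribution_le_1
    by (intro mult_left_le power_le_one) auto
  show "0 \<le> real n * p k * (1 - p k) ^ n"
    using tail_term_nonneg k by simp
qed

lemma tail_index_ge_term:
  assumes "k \<ge> 1"
  shows "real n * p k * (1 - p k) ^ n \<le> tail_index p n"
  using finite_sum_le_infsum[OF tail_index_summable, of "{k}" n] assms tail_term_nonneg
  by (simp add: tail_index_def)

text \<open>Each term is at most \<open>real n * q ^ n * p k\<close>, and the weights sum to
  1.\<close>

lemma tail_index_le:
  assumes "\<And>k. k \<ge> 1 \<Longrightarrow> p k > 0 \<Longrightarrow> 1 - p k \<le> q"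
  shows "tail_index p n \<le> real n * q ^ n"
proof -
  have "tail_index p n \<le> real n * q ^ n * 1"
    unfolding tail_index_def
  proof (rule has_sum_mono[OF has_sum_infsum[OF tail_index_summable]
        has_sum_cmult_right[OF prob_distribution_has_sum]])
    fix k :: nat assume k: "k \<in> {1..}"
    show "real n * p k * (1 - p k) ^ n \<le> real n * q ^ n * p k"
    proof (cases "p k > 0")
      case True
      then have "(1 - p k) ^ n \<le> q ^ n"
        using assms k prob_distribution_le_1 by (intro power_mono) auto
      then have "real n * p k * (1 - p k) ^ n \<le> real n * p k * q ^ n"
        using True by (intro mult_left_mono) auto
      then show ?thesis by (simp add: mult_ac)
    next
      \<comment> \<open>The hypothesis on \<open>q\<close> says nothing about zero weights, but for
        these both sides vanish.\<close>
      case False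
      then have "p k = 0" using prob_distribution_nonneg[of k] k by simp
      then show ?thesis by simp
    qed
  qed
  then show ?thesis by simp
qed

text \<open>Otherwise all of the infinitely many positive weights are at least
  \<open>\<epsilon>\<close>, and more than \<open>1 / \<epsilon>\<close> of them already have total
  mass above 1.\<close>

lemma prob_distribution_ex_small:
  assumes inf: "infinite {k\<in>{1..}. p k > 0}" and "\<epsilon> > 0"
  obtains k where "k \<ge> 1" "0 < p k" "p k < \<epsilon>"
proof (rule ccontr)
  assume "\<not> thesis"
  with that have ge: "p k \<ge> \<epsilon>" if "k \<ge> 1" "p k > 0" for k
    using not_le that by blast
  obtain N :: nat where N: "1 < real N * \<epsilon>"
    using reals_Archimedean3[OF \<open>\<epsilon> > 0\<close>] by blast
  obtain F where F: "finite F" "card F = N" "F \<subseteq> {k\<in>{1..}. p k > 0}"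
    using infinite_arbitrarily_large[OF inf] by blast
  have "real N * \<epsilon> \<le> sum p F"
    using F ge sum_bounded_below[of F \<epsilon> p] by auto
  also have "\<dots> \<le> 1"
    using F by (intro prob_distribution_sum_le_1) auto
  finally show False using N by simp
qed

end

theorem corollary1:
  fixes p :: "nat \<Rightarrow> real"
  assumes "prob_distribution p"
  shows "effective_cardinality p < \<infinity> \<longleftrightarrow>
    (\<exists>q\<^sub>0. 0 < q\<^sub>0 \<and> q\<^sub>0 < 1 \<and> le_bigo (tail_index p) (\<lambda>n. real n * q\<^sub>0 ^ n))"
  unfolding effective_cardinality_finite_iff
proof
  let ?S = "{k\<in>{1..}. p k > 0}"
  assume fin: "finite ?S"
  define q where "q = Max (insert (1/2) ((\<lambda>k. 1 - p k) ` ?S))"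
  have "1/2 \<le> q"
    unfolding q_def using fin by (intro Max_ge) auto
  moreover have "q < 1"
    using fin by (auto simp: q_def)
  moreover have "1 - p k \<le> q" if "k \<ge> 1" "p k > 0" for k
    using fin that by (auto simp: q_def intro!: Max_ge)
  then have "tail_index p n \<le> 1 * (real n * q ^ n)" for n
    using tail_index_le[OF assms] by simp
  then have "le_bigo (tail_index p) (\<lambda>n. real n * q ^ n)"
    unfolding le_bigo_def by (intro exI[of _ 1]) simp
  ultimately show "\<exists>q\<^sub>0. 0 < q\<^sub>0 \<and> q\<^sub>0 < 1 \<and> le_bigo (tail_index p) (\<lambda>n. real n * q\<^sub>0 ^ n)"
    by (intro exI[of _ q]) auto
next
  assume "\<exists>q\<^sub>0. 0 < q\<^sub>0 \<and> q\<^sub>0 < 1 \<and> le_bigo (tail_index p) (\<lambda>n. real n * q\<^sub>0 ^ n)"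
  then obtain q C where q: "0 < q" "q < 1"
    and le: "\<forall>\<^sub>F n in sequentially. tail_index p n \<le> C * (real n * q ^ n)"
    by (auto simp: le_bigo_def)
  show "finite {k\<in>{1..}. p k > 0}"
  proof (rule ccontr)
    assume "infinite {k\<in>{1..}. p k > 0}"
    then obtain k where k: "k \<ge> 1" "0 < p k" "p k < 1 - q"
      using prob_distribution_ex_small[OF assms, of "1 - q"] q by auto
    \<comment> \<open>The ratio of the two decay rates. It exceeds 1 because
      \<open>p k < 1 - q\<close>, so its powers eventually pass the constant
      \<open>C / p k\<close>.\<close>
    let ?r = "(1 - p k) / q"
    have "1 < ?r" using k q by simp
    then obtain m where m: "C / p k < ?r ^ m"
      using real_arch_pow by blast
    have "\<forall>\<^sub>F n in sequentially. C / p k < ?r ^ n"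
      using eventually_ge_at_top[of m]
    proof eventually_elim
      case (elim n)
      then have "?r ^ m \<le> ?r ^ n"
        using \<open>1 < ?r\<close> by (intro power_increasing) auto
      then show ?case using m by simp
    qed
    \<comment> \<open>Positivity of \<open>n\<close> is requested so that the common factor
      \<open>real n\<close> can be cancelled.\<close>
    from eventually_happens[OF eventually_conj[OF eventually_conj[OF le this]
        eventually_gt_at_top[of 0]]]
    obtain n where n: "tail_index p n \<le> C * (real n * q ^ n)" "C / p k < ?r ^ n" "n > 0"
      by auto
    have "real n * (p k * (1 - p k) ^ n) \<le> real n * (C * q ^ n)"
      using tail_index_ge_term[OF assms k(1), of n] n(1) by (simp add: mult_ac)
    then have "p k * (1 - p k) ^ n \<le> C * q ^ n"
      using n(3) by simp
    \<comment> \<open>Clearing denominators in \<open>C / p k < ?r ^ n\<close> gives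
      \<open>C * q ^ n < p k * (1 - p k) ^ n\<close>, the opposite of the bound just
      derived.\<close>
    with n(2) k q show False
      by (simp add: field_simps power_divide)
  qed
qed

end
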